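(* Let $n\ge 1$ and let $H=(H_{ij})_{i,j\in[n]}\in M_n(\mathbb{C})$ be a Hermitian matrix with associated nonbacktracking matrix $B$. For $x\ge 0$ define $f(x)=x+x^{-1}$ if $x\ge 1$ and $f(x)=2$ if $0\le x\le 1$. Then $$\|H\|\le \|H\|_{2\to\infty}\, f\!\left(\frac{\rho(B)}{\|H\|_{2\to\infty}}\right)+7\,\|H\|_{1\to\infty}.$$
   Context: Notation: $[n]=\{1,\dots,n\}$. For a square matrix $M$, $\sigma(M)$ is its spectrum, $\rho(M)=\max_{\lambda\in\sigma(M)}|\lambda|$ its spectral radius, and $\|M\|$ its $\ell^2\to\ell^2$ operator norm. For $H\in M_n(\mathbb{C})$, $$\|H\|_{2\to\infty}=\max_i\sqrt{\sum_j|H_{ij}|^2},\qquad \|H\|_{1\to\infty}=\max_{i,j}|H_{ij}|.$$ The nonbacktracking matrix associated with $H$ is the matrix $B=(B_{ef})_{e,f\in[n]^2}\in M_{n^2}(\mathbb{C})$ defined for $e=(i,j)\in[n]^2$ and $f=(k,l)\in[n]^2$ by $B_{ef}=H_{kl}\,\mathbf{1}_{j=k}\,\mathbf{1}_{i\ne l}$. When $H=0$, the right-hand side of the claimed inequality is interpreted as $0$. *)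

theory Defs
  imports "HOL-Analysis.Analysis"
begin

text \<open>The index set $[n]$ is rendered by a finite type \<open>'n\<close>, with \<open>n = CARD('n) \<ge> 1\<close>, and
  $[n]^2$ by \<open>'n \<times> 'n\<close>.\<close>

definition hermitian_matrix :: "complex^'n^'n \<Rightarrow> bool" where
  "hermitian_matrix H \<longleftrightarrow> (\<forall>i j. H $ i $ j = cnj (H $ j $ i))"

definition matrix_spectrum :: "complex^'n^'n \<Rightarrow> complex set" where
  "matrix_spectrum M = {z. \<exists>v. v \<noteq> 0 \<and> M *v v = z *s v}"

definition matrix_spectral_radius :: "complex^'n^'n \<Rightarrow> real" where
  "matrix_spectral_radius M = Max (cmod ` matrix_spectrum M)"

text \<open>The norm on \<^typ>\<open>complex^'n\<close> is the $\ell^2$ norm, so \<^const>\<open>onorm\<close> is the operator norm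
  from $\ell^2$ to $\ell^2$.\<close>

definition l2_opnorm :: "complex^'n^'n \<Rightarrow> real" where
  "l2_opnorm M = onorm ((*v) M)"

definition norm_2_to_inf :: "complex^'n^'n \<Rightarrow> real" where
  "norm_2_to_inf H = (MAX i. sqrt (\<Sum>j\<in>UNIV. (cmod (H $ i $ j))\<^sup>2))"

definition norm_1_to_inf :: "complex^'n^'n \<Rightarrow> real" where
  "norm_1_to_inf H = (MAX (i, j). cmod (H $ i $ j))"

definition nonbacktracking_matrix :: "complex^'n^'n \<Rightarrow> complex^('n \<times> 'n)^('n \<times> 'n)" where
  "nonbacktracking_matrix H =
     (\<chi> e f. case (e, f) of ((i, j), (k, l)) \<Rightarrow>
        H $ k $ l * of_bool (j = k) * of_bool (i \<noteq> l))"

text \<open>Only the values at \<open>x \<ge> 0\<close> are meaningful.\<close>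

definition edge_fun :: "real \<Rightarrow> real" where
  "edge_fun x = (if 1 \<le> x then x + inverse x else 2)"

end

theory Submission imports Defs begin

text \<open>
  Write $\sigma$ and $\delta$ for the two norms \<^const>\<open>norm_2_to_inf\<close> and
  \<^const>\<open>norm_1_to_inf\<close> of $H$, and $\rho$ for the spectral radius of its nonbacktracking
  matrix $B$. The proof compares $H$ with an Ihara-Bass matrix $A(t)$, a Hermitian $n \times n$
  matrix depending on a real parameter $t > \delta$, with three properties.

  \<^item> A vector in the kernel of $A(t)$ can be unfolded to an eigenvector of $B$ with eigenvalue $t$
    (\<open>ihara_bass\<close>). The spectrum of $B$ is finite, so every real eigenvalue is at most $\rho$, and
    $A(t)$ is injective for $t > \rho$.
  \<^item> The matrix $H + t A(t) - t I$ has operator norm at most $\sigma^2 / (t - \delta)$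
    (\<open>ihara_bass_matrix_residual\<close>), by the Schur test on its row sums.
  \<^item> Consequently $A(t)$ is close to $I$ for large $t$, hence positive definite there. A continuous
    family of Hermitian matrices can lose positive definiteness only at a parameter where it is
    singular, so $A(t)$ is positive definite for all $t > \max(\rho, \delta)$
    (\<open>ihara_bass_matrix_pos_def\<close>).

  Dropping the term with $A(t)$ from the second property gives
  $\langle x, H x\rangle \le (t + \sigma^2 / (t - \delta)) \|x\|^2$. The matrix $-H$ has the same
  $\sigma$, $\delta$ and $\rho$, so the same bound holds for it, and
  $\|H\| \le t + \sigma^2 / (t - \delta)$ for all $t > \max(\rho, \delta)$. The choice
  $t = \max(\rho, \sigma) + \delta$ yields $\|H\| \le \sigma f(\rho / \sigma) + \delta$.

  The real inner product on \<^typ>\<open>complex^'n\<close> is the real part of the Hermitian one. A Hermitian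
  matrix is self-adjoint for it, so positivity can be discussed in a real inner product space.
\<close>

section \<open>Self-adjoint operators and their quadratic forms\<close>

text \<open>Polarisation bounds $\langle w, T x\rangle$ by the quadratic form at $x + w$ and $x - w$, and
  the parallelogram law adds the two contributions up. Taking for $w$ the multiple of $T x$ that is as
  long as $x$ turns the left-hand side into $\|x\| \|T x\|$.\<close>

lemma self_adjoint_norm_le:
  fixes T :: "'a::real_inner \<Rightarrow> 'a"
  assumes lin: "linear T" and adj: "\<And>x y. T x \<bullet> y = x \<bullet> T y"
    and bd: "\<And>x. \<bar>x \<bullet> T x\<bar> \<le> K * (norm x)\<^sup>2"
  shows "norm (T x) \<le> K * norm x"
proof (cases "T x = 0 \<or> x = 0")
  case True
  have "0 \<le> K * norm x"
  proof (cases "x = 0")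
    case False
    have "0 \<le> K * (norm x)\<^sup>2" using bd[of x] by linarith
    then show ?thesis using False by (simp add: zero_le_mult_iff)
  qed simp
  with True show ?thesis using lin by (auto simp: linear_0)
next
  case False
  define c where "c = norm x / norm (T x)"
  define w where "w = c *\<^sub>R T x"
  have nw: "norm w = norm x" using False by (simp add: w_def c_def)
  have "4 * (w \<bullet> T x) = (x + w) \<bullet> T (x + w) - (x - w) \<bullet> T (x - w)"
    using adj[of w x] by (simp add: linear_add[OF lin] linear_diff[OF lin] inner_simps inner_commute)
  also have "\<dots> \<le> K * (norm (x + w))\<^sup>2 + K * (norm (x - w))\<^sup>2"
    using bd[of "x + w"] bd[of "x - w"] by linarith
  also have "\<dots> = 4 * (K * (norm x)\<^sup>2)"
    using nw by (simp add: power2_norm_eq_inner norm_eq inner_simps inner_commute algebra_simps)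
  finally have "w \<bullet> T x \<le> K * (norm x)\<^sup>2" by simp
  moreover have "w \<bullet> T x = norm x * norm (T x)"
    using False by (simp add: w_def c_def dot_square_norm power2_eq_square)
  ultimately have "norm x * norm (T x) \<le> norm x * (K * norm x)"
    by (simp add: power2_eq_square mult_ac)
  then show ?thesis using False by simp
qed

text \<open>If $T v \ne 0$, moving from $v$ a little in the direction $-T v$ would make the form
  negative.\<close>

lemma psd_null_vector:
  fixes T :: "'a::real_inner \<Rightarrow> 'a"
  assumes lin: "linear T" and adj: "\<And>x y. T x \<bullet> y = x \<bullet> T y"
    and psd: "\<And>x. 0 \<le> x \<bullet> T x" and null: "v \<bullet> T v = 0"
  shows "T v = 0"
proof -
  define w where "w = T v"
  define a where "a = w \<bullet> w"
  define b where "b = w \<bullet> T w"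
  \<comment> \<open>The form at $v + t w$ is $2 t a + t^2 b$. Its minimiser is $t = - a / b$; the denominator
    $b + 1$ avoids the case $b = 0$ and still makes the value negative unless $a = 0$.\<close>
  define t where "t = - a / (b + 1)"
  have b: "b \<ge> 0" using psd by (simp add: b_def)
  have "v \<bullet> T w = a" using adj[of v w] by (simp add: w_def a_def)
  then have "(v + t *\<^sub>R w) \<bullet> T (v + t *\<^sub>R w) = 2 * t * a + t\<^sup>2 * b"
    using null by (simp add: linear_add[OF lin] linear_scale[OF lin] inner_simps a_def b_def
        power2_eq_square distrib_left mult.assoc flip: w_def)
  then have "0 \<le> (2 * t * a + t\<^sup>2 * b) * (b + 1)\<^sup>2" using psd[of "v + t *\<^sub>R w"] by simp
  also have "\<dots> = 2 * a * (t * (b + 1)) * (b + 1) + (t * (b + 1))\<^sup>2 * b"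
    by (simp add: power2_eq_square algebra_simps)
  also have "t * (b + 1) = - a" using b by (simp add: t_def)
  also have "2 * a * - a * (b + 1) + (- a)\<^sup>2 * b = - (a\<^sup>2 * (b + 2))"
    by (simp add: power2_eq_square algebra_simps)
  finally have "a\<^sup>2 * (b + 2) \<le> 0" by simp
  then have "a = 0" using b by (simp add: mult_le_0_iff)
  then show ?thesis by (simp add: a_def w_def)
qed

text \<open>If positivity fails at $a$, let $s$ be the last parameter at which some unit vector has a
  nonpositive form; it exists by compactness of the unit sphere. Just above $s$ the form is positive,
  so at $s$ it is positive semidefinite by continuity, but it vanishes at some unit vector. By
  \<open>psd_null_vector\<close> that vector lies in the kernel of $T_s$.\<close>

lemma pos_def_continuation:
  fixes T :: "real \<Rightarrow> 'a::euclidean_space \<Rightarrow> 'a"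
  assumes ab: "a \<le> b"
    and lin: "\<And>t. t \<in> {a..b} \<Longrightarrow> linear (T t)"
    and adj: "\<And>t x y. t \<in> {a..b} \<Longrightarrow> T t x \<bullet> y = x \<bullet> T t y"
    and cont: "continuous_on ({a..b} \<times> UNIV) (\<lambda>(t, x). x \<bullet> T t x)"
    and ker: "\<And>t x. t \<in> {a..b} \<Longrightarrow> T t x = 0 \<Longrightarrow> x = 0"
    and pd: "\<And>x. x \<noteq> 0 \<Longrightarrow> 0 < x \<bullet> T b x"
    and "x \<noteq> 0"
  shows "0 < x \<bullet> T a x"
proof (rule ccontr)
  assume neg: "\<not> 0 < x \<bullet> T a x"
  define P where "P = {a..b} \<times> sphere (0::'a) 1"
  define Z where "Z = {p \<in> P. (case p of (t, x) \<Rightarrow> x \<bullet> T t x) \<le> 0}"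
  have normalise: "\<exists>y. norm y = 1 \<and> y \<bullet> T t y \<le> 0"
    if "t \<in> {a..b}" "x \<noteq> 0" "x \<bullet> T t x \<le> 0" for t x
  proof (intro exI conjI)
    show "norm (x /\<^sub>R norm x) = 1" using that by simp
    show "(x /\<^sub>R norm x) \<bullet> T t (x /\<^sub>R norm x) \<le> 0"
      using that by (simp add: linear_scale[OF lin] mult_nonneg_nonpos)
  qed
  have "compact P" by (simp add: P_def compact_Times)
  have "closed Z"
    unfolding Z_def
    by (rule continuous_on_closed_Collect_le[OF continuous_on_subset[OF cont]])
       (auto simp: P_def intro!: continuous_intros closed_Times)
  then have "compact Z"
    using \<open>compact P\<close> by (metis (no_types, lifting) Z_def compact_Int_closed inf.absorb_iff2 mem_Collect_eq subsetI)
  then have "compact (fst ` Z)"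
    by (intro compact_continuous_image) (auto intro!: continuous_intros)
  moreover have "fst ` Z \<noteq> {}"
    using normalise[of a x] neg ab \<open>x \<noteq> 0\<close> by (auto simp: Z_def P_def)
  ultimately obtain s where s: "s \<in> fst ` Z" "\<And>t. t \<in> fst ` Z \<Longrightarrow> t \<le> s"
    using compact_attains_sup by metis
  then obtain v where v: "s \<in> {a..b}" "norm v = 1" "v \<bullet> T s v \<le> 0"
    by (auto simp: Z_def P_def)
  then have "s < b" using pd[of v] by (cases "s = b"; cases "v = 0") auto
  have above: "0 < y \<bullet> T t y" if ty: "t \<in> {s<..b}" "y \<noteq> 0" for t y
  proof (rule ccontr)
    assume "\<not> 0 < y \<bullet> T t y"
    then obtain z where "norm z = 1" "z \<bullet> T t z \<le> 0" using normalise[of t y] ty v by (auto simp: not_less)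
    then have "(t, z) \<in> Z" using ty v by (auto simp: Z_def P_def)
    then show False using s(2)[of t] ty by force
  qed
  have psd: "0 \<le> y \<bullet> T s y" for y
  proof -
    have "continuous_on {a..b} (\<lambda>t. case (t, y) of (t, x) \<Rightarrow> x \<bullet> T t x)"
      by (rule continuous_on_compose2[OF cont]) (auto intro!: continuous_intros)
    then have "continuous_on {a..b} (\<lambda>t. y \<bullet> T t y)" by simp
    then have "continuous_on {s..b} (\<lambda>t. y \<bullet> T t y)"
      by (rule continuous_on_subset) (use v in auto)
    then have "((\<lambda>t. y \<bullet> T t y) \<longlongrightarrow> y \<bullet> T s y) (at s within {s..b})"
      using \<open>s < b\<close> by (auto simp: continuous_on)
    moreover have "\<forall>\<^sub>F t in at s within {s..b}. 0 \<le> y \<bullet> T t y"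
      unfolding eventually_at_filter
      using above[of _ y] by (cases "y = 0") (auto intro!: always_eventually less_imp_le)
    moreover have "at s within {s..b} \<noteq> bot" using \<open>s < b\<close>
      by (simp add: at_within_Icc_at_right)
    ultimately show ?thesis by (rule tendsto_lowerbound)
  qed
  have "T s v = 0"
    by (rule psd_null_vector) (use lin adj psd v psd[of v] in auto)
  then show False using ker[of s v] v by auto
qed

section \<open>The spectrum of a complex matrix\<close>

lemma poly_det_char:
  fixes M :: "'a::comm_ring_1^'n^'n"
  shows "\<exists>p. \<forall>z. poly p z = det (mat z - M)"
proof
  let ?p = "det (\<chi> i j. [:- (M $ i $ j), of_bool (i = j):])"
  show "\<forall>z. poly ?p z = det (mat z - M)"
  proof
    fix z
    have entry: "(mat z - M) $ i $ j = poly [:- (M $ i $ j), of_bool (i = j):] z" for i j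
      by (simp add: mat_def)
    show "poly ?p z = det (mat z - M)"
      unfolding det_def entry by (simp add: poly_sum poly_prod of_int_poly)
  qed
qed

text \<open>Eigenvalues are roots of the characteristic polynomial. This polynomial is nonzero because a
  number of modulus larger than the operator norm is no eigenvalue. Finiteness is what makes the
  maximum in \<^const>\<open>matrix_spectral_radius\<close> an upper bound.\<close>

lemma finite_matrix_spectrum: "finite (matrix_spectrum M)"
proof -
  obtain p where p: "\<And>z. poly p z = det (mat z - M)" using poly_det_char by metis
  have sub: "(mat z - M) *v v = z *s v - M *v v" for z v
  proof -
    have "mat z *v v = z *s v"
      by (simp add: vec_eq_iff matrix_vector_mult_def mat_def if_distrib if_distribR cong: if_cong)
    then show ?thesis by (simp add: matrix_vector_mult_diff_rdistrib)
  qed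
  have spec: "matrix_spectrum M = {z. poly p z = 0}"
  proof -
    have "(\<exists>v. v \<noteq> 0 \<and> M *v v = z *s v) \<longleftrightarrow> poly p z = 0" for z
    proof -
      have "poly p z \<noteq> 0 \<longleftrightarrow> (\<forall>v. (mat z - M) *v v = 0 \<longrightarrow> v = 0)"
        using matrix_left_invertible_ker[of "mat z - M"] invertible_left_inverse[of "mat z - M"]
          invertible_det_nz[of "mat z - M"] p[of z] by simp
      then show ?thesis by (auto simp: sub)
    qed
    then show ?thesis by (simp add: matrix_spectrum_def)
  qed
  have "p \<noteq> 0"
  proof
    assume "p = 0"
    obtain K where K: "\<And>x. norm (M *v x) \<le> norm x * K"
      using bounded_linear.bounded[OF matrix_vector_mul_bounded_linear[of M]] by blast
    define z where "z = complex_of_real (\<bar>K\<bar> + 1)"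
    have "z \<in> matrix_spectrum M" using spec \<open>p = 0\<close> by simp
    then obtain v where v: "v \<noteq> 0" "M *v v = z *s v" by (auto simp: matrix_spectrum_def)
    have "z *s v = (\<bar>K\<bar> + 1) *\<^sub>R v" by (simp add: vec_eq_iff z_def scaleR_conv_of_real[where 'a=complex] distrib_right)
    then have "(\<bar>K\<bar> + 1) * norm v \<le> norm v * K" using K[of v] v by simp
    then show False using v by (simp add: mult.commute)
  qed
  then show ?thesis unfolding spec by (rule poly_roots_finite)
qed
lemma matrix_spectral_radius_upper:
  "z \<in> matrix_spectrum M \<Longrightarrow> cmod z \<le> matrix_spectral_radius M"
  unfolding matrix_spectral_radius_def by (simp add: finite_matrix_spectrum)

lemma matrix_spectral_radius_uminus: "matrix_spectral_radius (- M) = matrix_spectral_radius M"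
proof -
  have sub: "cmod ` matrix_spectrum (- M) \<subseteq> cmod ` matrix_spectrum M" for M :: "complex^'a^'a"
  proof (rule image_subsetI)
    fix z assume "z \<in> matrix_spectrum (- M)"
    then obtain v where v: "v \<noteq> 0" "(- M) *v v = z *s v" by (auto simp: matrix_spectrum_def)
    have "M *v v = - ((- M) *v v)" by (simp add: vec_eq_iff matrix_vector_mult_def sum_negf)
    also have "\<dots> = (- z) *s v" by (simp add: v vec_eq_iff)
    finally have "- z \<in> matrix_spectrum M" using v by (auto simp: matrix_spectrum_def)
    then have "cmod (- z) \<in> cmod ` matrix_spectrum M" by (rule imageI)
    then show "cmod z \<in> cmod ` matrix_spectrum M" by simp
  qed
  have "cmod ` matrix_spectrum (- M) = cmod ` matrix_spectrum M"
    using sub[of M] sub[of "- M"] by simp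
  then show ?thesis by (simp add: matrix_spectral_radius_def)
qed

section \<open>Hermitian matrices\<close>

lemma hermitian_matrix_cnj: "hermitian_matrix H \<Longrightarrow> cnj (H $ i $ j) = H $ j $ i"
  by (metis hermitian_matrix_def)

lemma hermitian_cmod_sym: "hermitian_matrix H \<Longrightarrow> cmod (H $ i $ j) = cmod (H $ j $ i)"
  by (metis complex_mod_cnj hermitian_matrix_def)

lemma hermitian_matrix_adjoint:
  assumes "hermitian_matrix M"
  shows "(M *v x) \<bullet> y = x \<bullet> (M *v y)"
proof -
  have "(M $ i $ j * x $ j) \<bullet> y $ i = x $ j \<bullet> (M $ j $ i * y $ i)" for i j
    by (simp add: inner_complex_def algebra_simps flip: hermitian_matrix_cnj[OF assms, of i j])
  then show ?thesis
    unfolding inner_vec_def matrix_vector_mult_def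
    by (simp add: inner_sum_left inner_sum_right) (rule sum.swap)
qed

text \<open>By the inequality $2 |x_i| |x_j| \le |x_i|^2 + |x_j|^2$ and the symmetry of the moduli of
  the entries, each $|x_i|^2$ is counted with the sum of the moduli in row $i$ as its total weight.\<close>

lemma hermitian_schur_test:
  assumes "hermitian_matrix M" and row: "\<And>i. (\<Sum>j\<in>UNIV. cmod (M $ i $ j)) \<le> r"
  shows "\<bar>x \<bullet> (M *v x)\<bar> \<le> r * (norm x)\<^sup>2"
proof -
  let ?m = "\<lambda>i j. cmod (M $ i $ j)" and ?x = "\<lambda>i. cmod (x $ i)"
  have sym: "?m i j = ?m j i" for i j
    by (rule hermitian_cmod_sym[OF assms(1)])
  have "\<bar>x \<bullet> (M *v x)\<bar> \<le> (\<Sum>i\<in>UNIV. \<Sum>j\<in>UNIV. \<bar>x $ i \<bullet> (M $ i $ j * x $ j)\<bar>)"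
    unfolding inner_vec_def matrix_vector_mult_def
    by (simp add: inner_sum_right) (intro order_trans[OF sum_abs] sum_mono sum_abs)
  also have "\<dots> \<le> (\<Sum>i\<in>UNIV. \<Sum>j\<in>UNIV. ?m i j * (?x i)\<^sup>2 / 2 + ?m j i * (?x j)\<^sup>2 / 2)"
  proof (intro sum_mono)
    fix i j
    have "\<bar>x $ i \<bullet> (M $ i $ j * x $ j)\<bar> \<le> ?m i j * (?x i * ?x j)"
      using Cauchy_Schwarz_ineq2[of "x $ i" "M $ i $ j * x $ j"] by (simp add: norm_mult mult_ac)
    also have "\<dots> \<le> ?m i j * (((?x i)\<^sup>2 + (?x j)\<^sup>2) / 2)"
      using sum_squares_bound[of "?x i" "?x j"] by (intro mult_left_mono) auto
    finally show "\<bar>x $ i \<bullet> (M $ i $ j * x $ j)\<bar> \<le> ?m i j * (?x i)\<^sup>2 / 2 + ?m j i * (?x j)\<^sup>2 / 2"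
      by (simp add: sym[of j i] algebra_simps add_divide_distrib)
  qed
  also have "\<dots> = (\<Sum>i\<in>UNIV. \<Sum>j\<in>UNIV. ?m i j * (?x i)\<^sup>2 / 2) + (\<Sum>i\<in>UNIV. \<Sum>j\<in>UNIV. ?m j i * (?x j)\<^sup>2 / 2)"
    by (simp add: sum.distrib)
  also have "(\<Sum>i\<in>UNIV. \<Sum>j\<in>UNIV. ?m j i * (?x j)\<^sup>2 / 2) = (\<Sum>i\<in>UNIV. \<Sum>j\<in>UNIV. ?m i j * (?x i)\<^sup>2 / 2)"
    by (rule sum.swap)
  also have "(\<Sum>i\<in>UNIV. \<Sum>j\<in>UNIV. ?m i j * (?x i)\<^sup>2 / 2) + (\<Sum>i\<in>UNIV. \<Sum>j\<in>UNIV. ?m i j * (?x i)\<^sup>2 / 2)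
      = (\<Sum>i\<in>UNIV. (\<Sum>j\<in>UNIV. ?m i j) * (?x i)\<^sup>2)"
    by (simp add: sum_distrib_right flip: sum.distrib)
  also have "\<dots> \<le> (\<Sum>i\<in>UNIV. r * (?x i)\<^sup>2)"
    using row by (intro sum_mono mult_right_mono) auto
  also have "\<dots> = r * (norm x)\<^sup>2"
    by (simp add: sum_distrib_left norm_vec_def L2_set_def sum_nonneg)
  finally show ?thesis .
qed

section \<open>Entrywise norms\<close>

lemma cmod_le_norm_1_to_inf: "cmod (H $ i $ j) \<le> norm_1_to_inf H"
proof -
  have "(case (i, j) of (i, j) \<Rightarrow> cmod (H $ i $ j)) \<in> range (\<lambda>(i, j). cmod (H $ i $ j))"
    by (rule rangeI)
  then show ?thesis unfolding norm_1_to_inf_def by (intro Max_ge) simp_all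
qed

lemma norm_1_to_inf_nonneg: "0 \<le> norm_1_to_inf H"
  using order_trans[OF norm_ge_zero cmod_le_norm_1_to_inf] .

lemma row_sqrt_le_norm_2_to_inf: "sqrt (\<Sum>j\<in>UNIV. (cmod (H $ i $ j))\<^sup>2) \<le> norm_2_to_inf H"
  unfolding norm_2_to_inf_def by (rule Max_ge) auto

lemma norm_2_to_inf_nonneg: "0 \<le> norm_2_to_inf H"
  by (rule order_trans[OF _ row_sqrt_le_norm_2_to_inf]) (simp add: sum_nonneg)

lemma row_sum_le_norm_2_to_inf: "(\<Sum>j\<in>UNIV. (cmod (H $ i $ j))\<^sup>2) \<le> (norm_2_to_inf H)\<^sup>2"
  by (rule sqrt_le_D[OF row_sqrt_le_norm_2_to_inf])

lemma norm_1_to_inf_le_norm_2_to_inf: "norm_1_to_inf H \<le> norm_2_to_inf H"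
proof -
  have "cmod (H $ i $ j) \<le> norm_2_to_inf H" for i j
  proof -
    have "(cmod (H $ i $ j))\<^sup>2 \<le> (\<Sum>j\<in>UNIV. (cmod (H $ i $ j))\<^sup>2)"
      by (rule member_le_sum) auto
    then show ?thesis
      using power2_le_imp_le[OF order_trans[OF _ row_sum_le_norm_2_to_inf] norm_2_to_inf_nonneg] by blast
  qed
  then show ?thesis unfolding norm_1_to_inf_def by (subst Max_le_iff) auto
qed

section \<open>The Ihara-Bass matrix\<close>

text \<open>For Hermitian $H$ the number $|H_{ij}|^2$ equals $H_{ij} H_{ji}$, so this is the matrix
  $M(t) - H(t)$ of the Ihara-Bass formula, with $M(t)$ diagonal,
  $M(t)_{ii} = 1 + \sum_k H_{ik} H_{ki} / (t^2 - H_{ik} H_{ki})$ and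
  $H(t)_{ij} = t H_{ij} / (t^2 - H_{ij} H_{ji})$.\<close>

definition ihara_bass_matrix :: "complex^'n^'n \<Rightarrow> real \<Rightarrow> complex^'n^'n" where
  "ihara_bass_matrix H t = (\<chi> i j.
     of_bool (i = j) * (1 + (\<Sum>k\<in>UNIV. of_real ((cmod (H $ i $ k))\<^sup>2 / (t\<^sup>2 - (cmod (H $ i $ k))\<^sup>2))))
     - of_real (t / (t\<^sup>2 - (cmod (H $ i $ j))\<^sup>2)) * H $ i $ j)"

lemma hermitian_ihara_bass_matrix:
  assumes "hermitian_matrix H"
  shows "hermitian_matrix (ihara_bass_matrix H t)"
proof -
  have "ihara_bass_matrix H t $ i $ j = cnj (ihara_bass_matrix H t $ j $ i)" for i j
    unfolding ihara_bass_matrix_def vec_lambda_beta hermitian_cmod_sym[OF assms, of i j]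
    by (cases "i = j") (simp_all add: hermitian_matrix_cnj[OF assms])
  then show ?thesis unfolding hermitian_matrix_def by blast
qed

lemma sq_diff_pos:
  assumes "norm_1_to_inf H < t"
  shows "0 < t\<^sup>2 - (cmod (H $ i $ j))\<^sup>2"
  using assms cmod_le_norm_1_to_inf[of H i j] by (simp add: power_strict_mono)

text \<open>The eigenvalue equation of $B$ reads $t x_{ij} = y_j - H_{ji} x_{ji}$ with
  $y_j = \sum_l H_{jl} x_{jl}$. Solving it together with the equation for $x_{ji}$ expresses $x$
  through $y$ as $x_{ij} = (t y_j - H_{ji} y_i) / (t^2 - H_{ij} H_{ji})$. For this $x$, the definition
  of $y$ as a sum becomes exactly the condition that $y$ is in the kernel of the Ihara-Bass matrix.
  In particular $x$ cannot vanish unless $y$ does.\<close>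

lemma ihara_bass:
  assumes H: "hermitian_matrix H" and t: "norm_1_to_inf H < t"
    and y: "y \<noteq> 0" "ihara_bass_matrix H t *v y = 0"
  shows "complex_of_real t \<in> matrix_spectrum (nonbacktracking_matrix H)"
proof -
  define d where "d i j = complex_of_real (t\<^sup>2 - (cmod (H $ i $ j))\<^sup>2)" for i j
  have d0: "d i j \<noteq> 0" for i j using sq_diff_pos[OF t, of i j] by (simp add: d_def del: of_real_diff)
  have dsym: "d i j = d j i" for i j by (simp add: d_def hermitian_cmod_sym[OF H, of i])
  have HH: "H $ i $ j * H $ j $ i = of_real t ^ 2 - d i j" for i j
    using complex_norm_square[of "H $ i $ j"] by (simp add: d_def hermitian_matrix_cnj[OF H])
  define X where "X i j = (of_real t * y $ j - H $ j $ i * y $ i) / d i j" for i j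
  have row: "(\<Sum>l\<in>UNIV. H $ j $ l * X j l) = y $ j" for j
  proof -
    have "0 = (ihara_bass_matrix H t *v y) $ j" using y by simp
    also have "\<dots> = y $ j - (\<Sum>l\<in>UNIV. H $ j $ l * X j l)"
    proof -
      have "H $ j $ l * X j l = of_real (t / (t\<^sup>2 - (cmod (H $ j $ l))\<^sup>2)) * H $ j $ l * y $ l
        - of_real ((cmod (H $ j $ l))\<^sup>2 / (t\<^sup>2 - (cmod (H $ j $ l))\<^sup>2)) * y $ j" for l
      proof -
        have "of_real ((cmod (H $ j $ l))\<^sup>2) = H $ j $ l * H $ l $ j"
          by (simp add: HH d_def)
        then show ?thesis
          by (simp only: X_def flip: d_def) (simp add: d_def[symmetric] of_real_divide diff_divide_distrib right_diff_distrib mult_ac del: of_real_power of_real_diff)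
      qed
      then show ?thesis
        by (simp add: ihara_bass_matrix_def matrix_vector_mult_def left_diff_distrib sum_subtractf
            mult.assoc sum_of_bool_mult_eq distrib_right sum_distrib_right
            del: of_real_divide of_real_power of_real_diff)
    qed
    finally show ?thesis by simp
  qed
  define x where "x = (\<chi> e. X (fst e) (snd e))"
  have "x \<noteq> 0"
  proof
    assume "x = 0"
    then have "X i j = 0" for i j by (simp add: x_def vec_eq_iff)
    then show False using row y by (simp add: vec_eq_iff)
  qed
  moreover have "nonbacktracking_matrix H *v x = of_real t *s x"
  proof -
    have "(nonbacktracking_matrix H *v x) $ (i, j) = of_real t * X i j" for i j
    proof -
      have "(nonbacktracking_matrix H *v x) $ (i, j)
        = (\<Sum>k\<in>UNIV. \<Sum>l\<in>UNIV. of_bool (j = k) * (H $ k $ l * of_bool (i \<noteq> l) * X k l))"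
        by (simp add: nonbacktracking_matrix_def matrix_vector_mult_def x_def sum.cartesian_product
            split_def mult_ac flip: UNIV_Times_UNIV)
      also have "\<dots> = (\<Sum>l\<in>UNIV. H $ j $ l * of_bool (i \<noteq> l) * X j l)"
        by (simp only: sum_of_bool_mult_eq finite flip: sum_distrib_left) simp
      also have "\<dots> = (\<Sum>l\<in>UNIV. H $ j $ l * X j l - (if i = l then H $ j $ i * X j i else 0))"
        by (intro sum.cong) auto
      also have "\<dots> = y $ j - H $ j $ i * X j i"
        by (simp add: sum_subtractf row)
      also have "\<dots> = of_real t * X i j"
      proof -
        have "(y $ j - H $ j $ i * X j i) * d i j =
          y $ j * d i j - of_real t * (H $ j $ i * y $ i) + (H $ i $ j * H $ j $ i) * y $ j"
          using d0[of i j] by (simp add: X_def dsym[of j i] field_simps)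
        also have "\<dots> = of_real t * X i j * d i j"
        proof -
          have "X i j * d i j = of_real t * y $ j - H $ j $ i * y $ i" by (simp add: X_def d0)
          then have "of_real t * X i j * d i j = of_real t * (of_real t * y $ j - H $ j $ i * y $ i)"
            by (simp add: mult.assoc)
          then show ?thesis by (simp add: HH power2_eq_square algebra_simps)
        qed
        finally show ?thesis using d0[of i j] by simp
      qed
      finally show ?thesis .
    qed
    then show ?thesis by (simp add: vec_eq_iff x_def)
  qed
  ultimately show ?thesis unfolding matrix_spectrum_def by blast
qed

text \<open>The identity $t^2 / (t^2 - h^2) = 1 + h^2 / (t^2 - h^2)$ shows that $G = H + t A(t) - t I$
  has only small entries: with $w_{ij} = |H_{ij}|^2 / (t^2 - |H_{ij}|^2)$ they are $-w_{ij} H_{ij}$,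
  and $t \sum_k w_{ik}$ is added on the diagonal. The sum of the moduli in row $i$ is at most
  $(t + \delta) \sum_k w_{ik} \le (t + \delta) \sigma^2 / (t^2 - \delta^2)$.\<close>

lemma ihara_bass_matrix_residual:
  fixes H :: "complex^'n^'n"
  assumes H: "hermitian_matrix H" and t: "norm_1_to_inf H < t"
  shows "\<bar>x \<bullet> (H *v x) + t * (x \<bullet> (ihara_bass_matrix H t *v x)) - t * (norm x)\<^sup>2\<bar>
    \<le> (norm_2_to_inf H)\<^sup>2 / (t - norm_1_to_inf H) * (norm x)\<^sup>2"
proof -
  let ?h = "\<lambda>i j. cmod (H $ i $ j)" and ?d = "norm_1_to_inf H" and ?s = "norm_2_to_inf H"
  have d: "0 \<le> ?d" by (rule norm_1_to_inf_nonneg)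
  define G where "G = H + t *\<^sub>R ihara_bass_matrix H t - t *\<^sub>R mat 1"
  define w where "w i j = (?h i j)\<^sup>2 / (t\<^sup>2 - (?h i j)\<^sup>2)" for i j
  have w0: "0 \<le> w i j" for i j using sq_diff_pos[OF t, of i j] by (simp add: w_def)
  have G: "G $ i $ j = of_real (of_bool (i = j) * (t * (\<Sum>k\<in>UNIV. w i k))) - of_real (w i j) * H $ i $ j" for i j
  proof -
    have "t * (t / (t\<^sup>2 - (?h i j)\<^sup>2)) = 1 + w i j"
      using sq_diff_pos[OF t, of i j] by (simp add: w_def field_simps power2_eq_square)
    then have "of_real t * (of_real (t / (t\<^sup>2 - (?h i j)\<^sup>2)) * H $ i $ j) = (1 + of_real (w i j)) * H $ i $ j"
      by (metis mult.assoc of_real_1 of_real_add of_real_mult)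
    then show ?thesis
      by (simp add: G_def ihara_bass_matrix_def scaleR_conv_of_real[where 'a=complex] mat_def algebra_simps w_def[symmetric]
          del: of_real_divide of_real_power of_real_diff)
  qed
  have "hermitian_matrix G"
    unfolding hermitian_matrix_def
  proof (intro allI)
    fix i j
    have "w i j = w j i" by (simp add: w_def hermitian_cmod_sym[OF H, of i])
    then show "G $ i $ j = cnj (G $ j $ i)"
      by (cases "i = j") (simp_all add: G hermitian_matrix_cnj[OF H])
  qed
  moreover have "(\<Sum>j\<in>UNIV. cmod (G $ i $ j)) \<le> ?s\<^sup>2 / (t - ?d)" for i
  proof -
    have le: "w i j \<le> (?h i j)\<^sup>2 / (t\<^sup>2 - ?d\<^sup>2)" for j
      unfolding w_def using t d cmod_le_norm_1_to_inf[of H i j]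
      by (intro divide_left_mono mult_pos_pos sq_diff_pos diff_left_mono power_mono)
         (auto simp: power_strict_mono)
    have "(\<Sum>j\<in>UNIV. cmod (G $ i $ j)) \<le>
      (\<Sum>j\<in>UNIV. of_bool (i = j) * (t * (\<Sum>k\<in>UNIV. w i k)) + w i j * ?d)"
    proof (intro sum_mono)
      fix j
      have "cmod (G $ i $ j) \<le> \<bar>of_bool (i = j) * (t * (\<Sum>k\<in>UNIV. w i k))\<bar> + w i j * ?h i j"
        unfolding G using w0[of i j]
        by (intro order_trans[OF norm_triangle_ineq4]) (simp only: norm_of_real norm_mult abs_of_nonneg)
      also have "\<dots> \<le> of_bool (i = j) * (t * (\<Sum>k\<in>UNIV. w i k)) + w i j * ?d"
        using w0 t d cmod_le_norm_1_to_inf[of H i j]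
        by (intro add_mono mult_left_mono) (auto simp: abs_of_nonneg sum_nonneg)
      finally show "cmod (G $ i $ j) \<le> of_bool (i = j) * (t * (\<Sum>k\<in>UNIV. w i k)) + w i j * ?d" .
    qed
    also have "\<dots> = (t + ?d) * (\<Sum>k\<in>UNIV. w i k)"
      by (simp add: sum.distrib sum_of_bool_mult_eq distrib_right mult.commute[of ?d]
          del: of_bool_eq_0_iff flip: sum_distrib_right)
    also have "\<dots> \<le> (t + ?d) * (\<Sum>k\<in>UNIV. (?h i k)\<^sup>2 / (t\<^sup>2 - ?d\<^sup>2))"
      using t d le by (intro mult_left_mono sum_mono) auto
    also have "\<dots> = (\<Sum>k\<in>UNIV. (?h i k)\<^sup>2) / (t - ?d)"
      using t d by (simp add: power2_eq_square square_diff_square_factored flip: sum_divide_distrib)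
    also have "\<dots> \<le> ?s\<^sup>2 / (t - ?d)"
      using t row_sum_le_norm_2_to_inf by (intro divide_right_mono) auto
    finally show ?thesis .
  qed
  ultimately have "\<bar>x \<bullet> (G *v x)\<bar> \<le> ?s\<^sup>2 / (t - ?d) * (norm x)\<^sup>2" by (rule hermitian_schur_test)
  moreover have "(c *\<^sub>R A) *v x = c *\<^sub>R (A *v x)" for c :: real and A :: "complex^'n^'n"
    by (simp add: vec_eq_iff matrix_vector_mult_def scaleR_sum_right)
  then have "G *v x = H *v x + t *\<^sub>R (ihara_bass_matrix H t *v x) - t *\<^sub>R x"
    by (simp add: G_def matrix_vector_mult_add_rdistrib matrix_vector_mult_diff_rdistrib)
  ultimately show ?thesis by (simp add: inner_simps power2_norm_eq_inner)
qed

text \<open>The bound on the residual gives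
  $t \langle x, A(t) x\rangle \ge (t - \sigma^2 / (t - \delta) - K) \|x\|^2$ where $K$ bounds the
  norm of $H$; the factor in front of $\|x\|^2$ is positive for large $t$. On the way down from there to any
  $t > \max(\rho, \delta)$ the matrix stays injective by \<open>ihara_bass\<close>.\<close>

lemma ihara_bass_matrix_pos_def:
  fixes H :: "complex^'n^'n"
  assumes H: "hermitian_matrix H" and t: "norm_1_to_inf H < t"
    and rho: "matrix_spectral_radius (nonbacktracking_matrix H) < t" and "x \<noteq> 0"
  shows "0 < x \<bullet> (ihara_bass_matrix H t *v x)"
proof -
  let ?d = "norm_1_to_inf H" and ?s = "norm_2_to_inf H" and ?A = "ihara_bass_matrix H"
  have d: "0 \<le> ?d" by (rule norm_1_to_inf_nonneg)
  obtain K where K: "K > 0" "\<And>x. norm (H *v x) \<le> norm x * K"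
    using bounded_linear.pos_bounded[OF matrix_vector_mul_bounded_linear[of H]] by blast
  \<comment> \<open>The summand $1$ and $t > \delta$ give $b - \delta \ge 1$, so the residual is at most $\sigma^2$,
    and then $b > \sigma^2 + K$ suffices.\<close>
  define b where "b = t + 1 + ?s\<^sup>2 + K"
  have tb: "t \<le> b" using K by (simp add: b_def add_nonneg_nonneg)
  show ?thesis
  proof (rule pos_def_continuation[where T = "\<lambda>s x. ?A s *v x" and a = t and b = b])
    fix s x assume s: "s \<in> {t..b}" and ker: "?A s *v x = 0"
    show "x = 0"
    proof (rule ccontr)
      assume "x \<noteq> 0"
      then have "complex_of_real s \<in> matrix_spectrum (nonbacktracking_matrix H)"
        using ihara_bass[OF H _ _ ker] s t by auto
      then show False using matrix_spectral_radius_upper[of "of_real s"] s rho by fastforce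
    qed
  next
    fix x :: "complex^'n" assume "x \<noteq> 0"
    then have x2: "0 < (norm x)\<^sup>2" by simp
    have b1: "1 \<le> b - ?d" using t K(1) zero_le_power2[of ?s] unfolding b_def by linarith
    then have bd: "?d < b" by simp
    have "x \<bullet> (H *v x) \<le> K * (norm x)\<^sup>2"
      using Cauchy_Schwarz_ineq2[of x "H *v x"] mult_left_mono[OF K(2)[of x], of "norm x"]
      by (simp add: power2_eq_square mult_ac)
    moreover have "?s\<^sup>2 / (b - ?d) * (norm x)\<^sup>2 \<le> ?s\<^sup>2 * (norm x)\<^sup>2"
      using b1 by (intro mult_right_mono) (auto simp: divide_le_eq mult_le_cancel_left1)
    ultimately have "b * (norm x)\<^sup>2 - (?s\<^sup>2 + K) * (norm x)\<^sup>2 \<le> b * (x \<bullet> (?A b *v x))"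
      using ihara_bass_matrix_residual[OF H bd, of x] by (simp add: algebra_simps)
    moreover have "0 < b * (norm x)\<^sup>2 - (?s\<^sup>2 + K) * (norm x)\<^sup>2"
      using t d x2 by (simp add: b_def flip: left_diff_distrib)
    ultimately have "0 < b * (x \<bullet> (?A b *v x))" by simp
    then show "0 < x \<bullet> (?A b *v x)" using bd d by (simp add: zero_less_mult_iff)
  next
    have "s\<^sup>2 - (cmod (H $ i $ j))\<^sup>2 \<noteq> 0" if "s \<in> {t..b}" for s i j
      using sq_diff_pos[of H s i j] t that by auto
    then have "continuous_on {t..b} (\<lambda>s. ?A s $ i $ j)" for i j
      unfolding ihara_bass_matrix_def vec_lambda_beta by (intro continuous_intros) blast+
    then have entry: "continuous_on ({t..b} \<times> UNIV) (\<lambda>p. ?A (fst p) $ i $ j)" for i j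
      by (rule continuous_on_compose2) (auto intro: continuous_intros)
    show "continuous_on ({t..b} \<times> UNIV) (\<lambda>(s, x). x \<bullet> (?A s *v x))"
      unfolding split_def inner_vec_def matrix_vector_mult_def vec_lambda_beta
      by (intro continuous_on_sum continuous_on_inner continuous_on_mult entry continuous_intros)
  qed (simp_all add: tb \<open>x \<noteq> 0\<close> hermitian_matrix_adjoint[OF hermitian_ihara_bass_matrix[OF H]])
qed

section \<open>The operator norm\<close>

lemma quadratic_form_upper:
  assumes H: "hermitian_matrix H" and t: "norm_1_to_inf H < t"
    and rho: "matrix_spectral_radius (nonbacktracking_matrix H) < t"
  shows "x \<bullet> (H *v x) \<le> (t + (norm_2_to_inf H)\<^sup>2 / (t - norm_1_to_inf H)) * (norm x)\<^sup>2"
proof -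
  have "0 \<le> t * (x \<bullet> (ihara_bass_matrix H t *v x))"
    using ihara_bass_matrix_pos_def[OF H t rho, of x] t norm_1_to_inf_nonneg[of H]
    by (cases "x = 0") auto
  then show ?thesis using ihara_bass_matrix_residual[OF H t, of x] by (simp add: algebra_simps)
qed

lemma nonbacktracking_matrix_uminus: "nonbacktracking_matrix (- H) = - nonbacktracking_matrix H"
  by (simp add: nonbacktracking_matrix_def vec_eq_iff)

text \<open>The operator norm of a Hermitian matrix is controlled by its quadratic form from both sides;
  the lower bound is the upper bound for $-H$, whose nonbacktracking matrix $-B$ has the
  same spectral radius as $B$.\<close>

lemma hermitian_opnorm_le:
  assumes H: "hermitian_matrix H" and t: "norm_1_to_inf H < t"
    and rho: "matrix_spectral_radius (nonbacktracking_matrix H) < t"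
  shows "l2_opnorm H \<le> t + (norm_2_to_inf H)\<^sup>2 / (t - norm_1_to_inf H)"
proof -
  have neg: "hermitian_matrix (- H)" "norm_1_to_inf (- H) = norm_1_to_inf H"
    "norm_2_to_inf (- H) = norm_2_to_inf H"
    using hermitian_matrix_cnj[OF H]
    by (simp_all add: hermitian_matrix_def norm_1_to_inf_def norm_2_to_inf_def)
  have mneg: "(- H) *v x = - (H *v x)" for x
    by (simp add: matrix_vector_mult_def vec_eq_iff sum_negf)
  have "\<bar>x \<bullet> (H *v x)\<bar> \<le> (t + (norm_2_to_inf H)\<^sup>2 / (t - norm_1_to_inf H)) * (norm x)\<^sup>2" for x
    using quadratic_form_upper[OF H t rho, of x] quadratic_form_upper[OF neg(1), of t x] t rho
    by (simp add: neg mneg nonbacktracking_matrix_uminus matrix_spectral_radius_uminus)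
  then show ?thesis unfolding l2_opnorm_def
    by (intro onorm_le self_adjoint_norm_le)
      (simp_all add: hermitian_matrix_adjoint[OF H] matrix_vector_mul_linear)
qed

theorem theorem2p2:
  fixes H :: "complex^'n^'n"
  assumes "hermitian_matrix H"
  shows "l2_opnorm H \<le>
    norm_2_to_inf H *
      edge_fun (matrix_spectral_radius (nonbacktracking_matrix H) / norm_2_to_inf H)
    + 7 * norm_1_to_inf H"
proof -
  define r where "r = matrix_spectral_radius (nonbacktracking_matrix H)"
  define s where "s = norm_2_to_inf H"
  define d where "d = norm_1_to_inf H"
  have sd: "0 \<le> d" "d \<le> s"
    by (simp_all add: s_def d_def norm_1_to_inf_nonneg norm_1_to_inf_le_norm_2_to_inf)
  show ?thesis
  proof (cases "d = 0")
    case True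
    then have "H = 0" using cmod_le_norm_1_to_inf[of H] by (simp add: vec_eq_iff d_def)
    moreover have "norm_2_to_inf (0 :: complex^'n^'n) = 0" by (simp add: norm_2_to_inf_def)
    moreover have "l2_opnorm (0 :: complex^'n^'n) = 0"
    proof -
      have "(*v) (0 :: complex^'n^'n) = (\<lambda>x. 0)" by auto
      then show ?thesis by (simp add: l2_opnorm_def onorm_zero)
    qed
    ultimately show ?thesis using True by (simp add: d_def)
  next
    case False
    \<comment> \<open>For $t = m + \delta$ the bound is $m + \sigma^2 / m + \delta$. On $m \ge \rho$ the best choice
      is $m = \sigma$ if that is allowed, and $m = \rho$ otherwise; this is the case distinction in $f$.
      Since $\delta > 0$ and $\sigma \ge \delta$, the parameter exceeds both $\rho$ and $\delta$.\<close>
    define m where "m = max r s"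
    have pos: "0 < d" "0 < s" "0 < m" using sd False by (simp_all add: m_def less_max_iff_disj)
    have "l2_opnorm H \<le> (m + d) + s\<^sup>2 / ((m + d) - d)"
      unfolding s_def d_def
      by (rule hermitian_opnorm_le[OF assms])
        (use pos sd in \<open>simp_all add: m_def flip: r_def s_def d_def\<close>)
    also have "\<dots> = s * edge_fun (r / s) + d"
    proof (cases "s \<le> r")
      case True
      then have "m = r" "0 < r" "1 \<le> r / s" using pos by (simp_all add: m_def)
      then show ?thesis using pos by (simp add: edge_fun_def distrib_left power2_eq_square)
    next
      case False
      then have "m = s" "\<not> 1 \<le> r / s" using pos by (simp_all add: m_def)
      then show ?thesis using pos by (simp add: edge_fun_def power2_eq_square)
    qed
    also have "\<dots> \<le> s * edge_fun (r / s) + 7 * d" using sd by simp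
    finally show ?thesis by (simp add: r_def s_def d_def)
  qed
qed

end
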